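(* Let $G=(V,E)$ be a finite undirected unweighted graph and let $\pi:V\to\{1,\dots,|V|\}$ be a vertex order (a bijection). The algorithm VC-PLL run on $(G,\pi)$ produces the canonical hierarchical hub labeling of $G$ with respect to $\pi$; that is, for all vertices $u,v\in V$, in the final output $u\in L(v)$ if and only if $u$ and $v$ are connected in $G$ and $u$ has the highest rank in $P_{uv}$, i.e. there is no $w\in P_{uv}$ with $\pi(w)<\pi(u)$.
   Context: A smaller value of $\pi$ means a higher rank. For vertices $u,v$, $P_{uv}$ is the set of all vertices lying on shortest paths between $u$ and $v$ (including $u$ and $v$). The canonical hierarchical hub labeling for $\pi$ assigns to each vertex $v$ the label consisting of those vertices $u$ (connected to $v$) that have the highest rank in $P_{uv}$. Algorithm VC-PLL. Each vertex $v$ holds a label $L(v)$ and a new label $\delta L(v)$, both finite sets of pairs (vertex, distance value). We write $u\in L(v)$ if some pair $(u,d)$ is in $L(v)$; for $h\in L(v)$ the recorded value is written $d(h,v)=d(v,h)$. A minimum over the empty set is $+\infty$. Initialization: ActiveVertices $=V$; for all $v$, $\delta L(v)=L(v)=\{(v,0)\}$. While ActiveVertices $\neq\emptyset$, perform one iteration (iterations are numbered $1,2,\dots$), starting with empty message sets: - Scatter: for every active vertex $a$, every edge $(a,v)$ and every $(u,d)\in\delta L(a)$, if $\pi(u)<\pi(v)$ and $u\notin L(v)$, then send the message $(u,d+1)$ to $v$. Afterwards set ActiveVertices $=\emptyset$. - Gather: for every vertex $v$ that received a message in this iteration (in any order, or in parallel): set $\delta L(v)=\emptyset$; for each distinct message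 $(u,d)$ received by $v$, perform the distance check $d<\min_{h\in L(u)\cap L(v)}\big(d(u,h)+d(h,v)\big)$ using the current labels; if it holds, add $(u,d)$ to $\delta L(v)$. After all messages of $v$ are treated, if $\delta L(v)\ne\emptyset$, replace $L(v)$ by $L(v)\cup\delta L(v)$ and add $v$ to ActiveVertices. The output is the final $L$. *)

theory Defs
  imports "Graph_Theory.Graph_Theory" "HOL-Library.Extended_Nat"
begin

text \<open>Undirected graphs are the finite, symmetric, loop-free digraphs without parallel arcs of the
  locale \<^locale>\<open>graph\<close>: an undirected edge is a pair of opposite arcs.\<close>

subsection \<open>Shortest paths and the canonical hierarchical hub labeling\<close>

definition shortest_path :: "('a, 'b) pre_digraph \<Rightarrow> 'a \<Rightarrow> 'b awalk \<Rightarrow> 'a \<Rightarrow> bool" where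
  "shortest_path G u p v \<longleftrightarrow>
     pre_digraph.apath G u p v \<and> (\<forall>q. pre_digraph.apath G u q v \<longrightarrow> length p \<le> length q)"

definition shortest_path_verts :: "('a, 'b) pre_digraph \<Rightarrow> 'a \<Rightarrow> 'a \<Rightarrow> 'a set" where
  "shortest_path_verts G u v =
     \<Union> {set (pre_digraph.awalk_verts G u p) | p. shortest_path G u p v}"

text \<open>A label is a set of pairs (hub, recorded distance).\<close>

type_synonym 'a labeling = "'a \<Rightarrow> ('a \<times> nat) set"

definition hubs :: "'a labeling \<Rightarrow> 'a \<Rightarrow> 'a set" where
  "hubs L v = fst ` L v"

text \<open>A smaller value of \<open>\<pi>\<close> means a higher rank.\<close>

definition canonical_hhl :: "('a, 'b) pre_digraph \<Rightarrow> ('a \<Rightarrow> nat) \<Rightarrow> 'a labeling \<Rightarrow> bool" where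
  "canonical_hhl G \<pi> L \<longleftrightarrow>
     (\<forall>u \<in> verts G. \<forall>v \<in> verts G.
        u \<in> hubs L v \<longleftrightarrow>
          u \<rightarrow>\<^sup>*\<^bsub>G\<^esub> v \<and> \<not> (\<exists>w \<in> shortest_path_verts G u v. \<pi> w < \<pi> u))"


subsection \<open>The algorithm VC-PLL as a transition system\<close>

text \<open>The gather stage is modelled by an arbitrary interleaving of the treatments of the individual
  messages at all receiving vertices. Treating the vertices one after the other in some order, and
  treating them all in parallel on the labels from the start of the stage, are special cases.
  Within an iteration a vertex is \<open>Pending\<close> once it has received a message, \<open>Busy\<close> while its
  messages are being treated, and \<open>Idle\<close> if it has no gathering to do or is done with it.\<close>

datatype phase = Idle | Pending | Busy

record 'a vc_config =
  label :: "'a labeling"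
  new_label :: "'a labeling"
  active :: "'a set"
  inbox :: "'a labeling"  \<comment> \<open>messages that are not yet treated\<close>
  phase :: "'a \<Rightarrow> phase"

definition vc_init :: "('a, 'b) pre_digraph \<Rightarrow> 'a vc_config" where
  "vc_init G =
     \<lparr>label = (\<lambda>v. {(v, 0)}), new_label = (\<lambda>v. {(v, 0)}), active = verts G,
      inbox = (\<lambda>v. {}), phase = (\<lambda>v. Idle)\<rparr>"

definition scatter_messages ::
  "('a, 'b) pre_digraph \<Rightarrow> ('a \<Rightarrow> nat) \<Rightarrow> 'a vc_config \<Rightarrow> 'a labeling" where
  "scatter_messages G \<pi> c v =
     {(u, d + 1) | u d a.
        a \<in> active c \<and> a \<rightarrow>\<^bsub>G\<^esub> v \<and> (u, d) \<in> new_label c a \<and>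
        \<pi> u < \<pi> v \<and> u \<notin> hubs (label c) v}"

text \<open>The infimum of the empty set in \<^typ>\<open>enat\<close> is \<open>\<infinity>\<close>.\<close>

definition label_distance :: "'a labeling \<Rightarrow> 'a \<Rightarrow> 'a \<Rightarrow> enat" where
  "label_distance L u v = Inf {enat (d\<^sub>1 + d\<^sub>2) | h d\<^sub>1 d\<^sub>2. (h, d\<^sub>1) \<in> L u \<and> (h, d\<^sub>2) \<in> L v}"

inductive vc_step ::
  "('a, 'b) pre_digraph \<Rightarrow> ('a \<Rightarrow> nat) \<Rightarrow> 'a vc_config \<Rightarrow> 'a vc_config \<Rightarrow> bool"
  for G :: "('a, 'b) pre_digraph" and \<pi> :: "'a \<Rightarrow> nat" where
  scatter:
    "vc_step G \<pi> c
       (c\<lparr>active := {}, inbox := M, phase := (\<lambda>v. if M v = {} then Idle else Pending)\<rparr>)"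
    if "active c \<noteq> {}" and "\<forall>v. phase c v = Idle" and "M = scatter_messages G \<pi> c"
| gather_start:
    "vc_step G \<pi> c
       (c\<lparr>new_label := (new_label c)(v := {}), phase := (phase c)(v := Busy)\<rparr>)"
    if "phase c v = Pending"
| gather_accept:
    "vc_step G \<pi> c
       (c\<lparr>new_label := (new_label c)(v := insert (u, d) (new_label c v)),
          inbox := (inbox c)(v := inbox c v - {(u, d)})\<rparr>)"
    if "phase c v = Busy" and "(u, d) \<in> inbox c v" and "enat d < label_distance (label c) u v"
| gather_reject:
    "vc_step G \<pi> c (c\<lparr>inbox := (inbox c)(v := inbox c v - {(u, d)})\<rparr>)"
    if "phase c v = Busy" and "(u, d) \<in> inbox c v" and "\<not> enat d < label_distance (label c) u v"
| gather_finish_changed: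
    "vc_step G \<pi> c
       (c\<lparr>label := (label c)(v := label c v \<union> new_label c v), active := insert v (active c),
          phase := (phase c)(v := Idle)\<rparr>)"
    if "phase c v = Busy" and "inbox c v = {}" and "new_label c v \<noteq> {}"
| gather_finish_unchanged:
    "vc_step G \<pi> c (c\<lparr>phase := (phase c)(v := Idle)\<rparr>)"
    if "phase c v = Busy" and "inbox c v = {}" and "new_label c v = {}"

definition vc_exit :: "'a vc_config \<Rightarrow> bool" where
  "vc_exit c \<longleftrightarrow> active c = {} \<and> (\<forall>v. phase c v = Idle)"

text \<open>There are no deadlocks: a run can only stop by leaving the while loop.\<close>

lemma vc_step_iff_not_exit: "(\<exists>c'. vc_step G \<pi> c c') \<longleftrightarrow> \<not> vc_exit c"
proof
  assume "\<exists>c'. vc_step G \<pi> c c'"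
  then obtain c' where "vc_step G \<pi> c c'" ..
  then show "\<not> vc_exit c"
    by cases (auto simp: vc_exit_def, (metis phase.distinct)+)
next
  assume not_exit: "\<not> vc_exit c"
  show "\<exists>c'. vc_step G \<pi> c c'"
  proof (cases "\<forall>v. phase c v = Idle")
    case True
    with not_exit have "active c \<noteq> {}"
      by (simp add: vc_exit_def)
    with True show ?thesis
      by (blast intro: vc_step.scatter)
  next
    case False
    then obtain v where "phase c v = Pending \<or> phase c v = Busy"
      by (metis phase.exhaust)
    then show ?thesis
    proof
      assume "phase c v = Pending"
      then show ?thesis
        by (blast intro: vc_step.gather_start)
    next
      assume busy: "phase c v = Busy"
      show ?thesis
      proof (cases "inbox c v = {}")
        case True
        with busy show ?thesis
          by (blast intro: vc_step.gather_finish_changed vc_step.gather_finish_unchanged)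
      next
        case False
        then obtain u d where "(u, d) \<in> inbox c v"
          by fastforce
        with busy show ?thesis
          by (blast intro: vc_step.gather_accept vc_step.gather_reject)
      qed
    qed
  qed
qed

definition vc_pll_terminates :: "('a, 'b) pre_digraph \<Rightarrow> ('a \<Rightarrow> nat) \<Rightarrow> bool" where
  "vc_pll_terminates G \<pi> \<longleftrightarrow>
     \<not> (\<exists>c. c 0 = vc_init G \<and> (\<forall>i::nat. vc_step G \<pi> (c i) (c (Suc i))))"

definition vc_pll_output :: "('a, 'b) pre_digraph \<Rightarrow> ('a \<Rightarrow> nat) \<Rightarrow> 'a labeling \<Rightarrow> bool" where
  "vc_pll_output G \<pi> L \<longleftrightarrow>
     (\<exists>c. (vc_step G \<pi>)\<^sup>*\<^sup>* (vc_init G) c \<and> vc_exit c \<and> L = label c)"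

end

theory Submission
  imports Defs
begin

text \<open>
  Call \<open>u\<close> a canonical hub of \<open>v\<close> at distance \<open>d\<close> if \<open>d\<close> is the distance of \<open>u\<close> and \<open>v\<close> and \<open>u\<close> has
  the highest rank in \<open>P\<^sub>u\<^sub>v\<close>. During iteration \<open>k\<close>, the label of a vertex that is not done with
  gathering consists of its canonical hubs at distance less than \<open>k\<close>, and the label of a vertex that
  is done of those at distance at most \<open>k\<close>; hence the order in which the vertices are treated does
  not matter. A message \<open>(u, k)\<close> at \<open>v\<close> for which \<open>u\<close> is not a canonical hub fails the
  distance check because the vertex of highest rank in \<open>P\<^sub>u\<^sub>v\<close> is a canonical hub of both
  \<open>u\<close> and \<open>v\<close> at distances less than \<open>k\<close>. If \<open>u\<close> is a canonical hub, then only \<open>u\<close> itself could make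
  the check fail, but \<open>u\<close> does not occur in the label of \<open>v\<close> yet. The message for a canonical hub
  is always sent, since \<open>u\<close> is a canonical hub of every vertex on a shortest path to \<open>v\<close>.
\<close>

section \<open>Label distances as comparisons over common hubs, and a decrease lemma for
  sums\<close>

lemma less_label_distance_iff:
  "enat k < label_distance L u v \<longleftrightarrow>
     (\<forall>h d e. (h, d) \<in> L u \<longrightarrow> (h, e) \<in> L v \<longrightarrow> k < d + e)"
proof -
  \<comment> \<open>A strict bound does not pass through an infimum, a non-strict one does; hence
    the detour over \<open>Suc k\<close>. Without a common hub both sides are true, the infimum
    being infinite.\<close>
  have "enat k < label_distance L u v \<longleftrightarrow> enat (Suc k) \<le> label_distance L u v"
    by (simp add: Suc_ile_eq)
  also have "\<dots> \<longleftrightarrow> (\<forall>h d e. (h, d) \<in> L u \<longrightarrow> (h, e) \<in> L v \<longrightarrow> Suc k \<le> d + e)"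
    unfolding label_distance_def le_Inf_iff by fastforce
  finally show ?thesis
    by (simp add: Suc_le_eq)
qed

lemma sum_fun_upd_less:
  fixes f :: "'a \<Rightarrow> nat"
  assumes "finite A" and "v \<in> A" and "x < f v"
  shows "sum (f(v := x)) A < sum f A"
  by (rule sum_strict_mono_ex1) (use assms in auto)

locale ranked_graph = graph G for G :: "('a, 'b) pre_digraph" +
  fixes \<pi> :: "'a \<Rightarrow> nat"
  assumes inj_rank: "inj_on \<pi> (verts G)"
begin

subsection \<open>Walks of given length and distances\<close>

text \<open>Fixing the exact length makes splitting and concatenation instances of
  \<open>relpow_add\<close>. Since \<open>walk 0 u u\<close> holds for every \<open>u\<close>, even
  outside the graph, the comparison with \<open>awalk\<close> assumes
  \<open>u \<in> verts G\<close>.\<close>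

definition walk :: "nat \<Rightarrow> 'a \<Rightarrow> 'a \<Rightarrow> bool" where
  "walk n u v \<longleftrightarrow> (u, v) \<in> arcs_ends G ^^ n"

definition has_dist :: "'a \<Rightarrow> 'a \<Rightarrow> nat \<Rightarrow> bool" where
  "has_dist u v d \<longleftrightarrow> walk d u v \<and> (\<forall>n. walk n u v \<longrightarrow> d \<le> n)"

lemma walk_0 [simp]: "walk 0 u v \<longleftrightarrow> u = v"
  by (simp add: walk_def)

lemma walk_append: "walk m u v \<Longrightarrow> walk n v w \<Longrightarrow> walk (m + n) u w"
  unfolding walk_def relpow_add by blast

lemma walk_split: "walk (m + n) u w \<Longrightarrow> \<exists>v. walk m u v \<and> walk n v w"
  unfolding walk_def relpow_add by blast

lemma walk_1 [simp]: "walk (Suc 0) u v \<longleftrightarrow> u \<rightarrow>\<^bsub>G\<^esub> v"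
  by (simp add: walk_def)

lemma walk_sym: "walk n u v \<Longrightarrow> walk n v u"
proof (induction n arbitrary: v)
  case (Suc n)
  then obtain w where "walk n u w" "w \<rightarrow>\<^bsub>G\<^esub> v"
    by (auto simp: walk_def)
  then have "walk (Suc 0) v w" "walk n w u"
    using Suc.IH sym_arcs by (auto intro: arcs_ends_symmetric)
  then show ?case
    using walk_append by fastforce
qed simp

lemma walk_in_verts:
  assumes "walk n u v"
  shows "u \<in> verts G \<longleftrightarrow> v \<in> verts G"
  using assms
proof (induction n arbitrary: v)
  case (Suc n)
  then obtain w where "walk n u w" "w \<rightarrow>\<^bsub>G\<^esub> v"
    by (auto simp: walk_def)
  then show ?case
    using Suc.IH adj_in_verts by blast
qed simp

lemma walk_iff_awalk:
  assumes "u \<in> verts G"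
  shows "walk n u v \<longleftrightarrow> (\<exists>p. awalk u p v \<and> length p = n)"
proof
  assume "walk n u v"
  then show "\<exists>p. awalk u p v \<and> length p = n"
  proof (induction n arbitrary: v)
    case 0
    with assms show ?case
      by (simp add: awalk_Nil_iff)
  next
    case (Suc n)
    then obtain w where "walk n u w" "w \<rightarrow>\<^bsub>G\<^esub> v"
      by (auto simp: walk_def)
    then obtain p e where "awalk u p w" "length p = n" "e \<in> arcs G" "tail G e = w" "head G e = v"
      using Suc.IH[OF \<open>walk n u w\<close>] by (auto simp: arcs_ends_conv)
    then have "awalk u (p @ [e]) v" "length (p @ [e]) = Suc n"
      using arc_implies_awalk by auto
    then show ?case
      by blast
  qed
next
  assume "\<exists>p. awalk u p v \<and> length p = n"
  then obtain p where "awalk u p v" "length p = n"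
    by blast
  then show "walk n u v"
  proof (induction p arbitrary: u n)
    case Nil
    then show ?case
      by (simp add: awalk_Nil_iff)
  next
    case (Cons e p)
    then have e: "e \<in> arcs G" "u = tail G e" "awalk (head G e) p v"
      by (simp_all add: awalk_Cons_iff)
    then have "walk (Suc 0) u (head G e)"
      by (simp add: in_arcs_imp_in_arcs_ends)
    moreover have "walk (length p) (head G e) v"
      using Cons.IH e by blast
    ultimately have "walk (Suc 0 + length p) u v"
      by (rule walk_append)
    with Cons.prems show ?case
      by simp
  qed
qed

lemma has_dist_unique: "has_dist u v d \<Longrightarrow> has_dist u v e \<Longrightarrow> d = e"
  by (simp add: has_dist_def order_antisym)

lemma has_dist_self [simp]: "has_dist u u d \<longleftrightarrow> d = 0"
  unfolding has_dist_def by (metis le_zero_eq walk_0 zero_le)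

lemma has_dist_sym: "has_dist u v d \<Longrightarrow> has_dist v u d"
  unfolding has_dist_def by (blast intro: walk_sym)

lemma walk_imp_has_dist:
  assumes "walk n u v"
  shows "\<exists>d \<le> n. has_dist u v d"
proof (intro exI conjI)
  show "(LEAST n. walk n u v) \<le> n"
    using assms by (rule Least_le)
  show "has_dist u v (LEAST n. walk n u v)"
    using assms by (auto simp: has_dist_def intro: LeastI Least_le)
qed

text \<open>A shorter walk from \<open>u\<close> to \<open>w\<close>, continued by the walk from
  \<open>w\<close> to \<open>v\<close>, would beat the distance of \<open>u\<close> and
  \<open>v\<close>.\<close>

lemma has_dist_left:
  assumes "has_dist u v (d + e)" and "walk d u w" and "walk e w v"
  shows "has_dist u w d"
  unfolding has_dist_def
proof (intro conjI allI impI)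
  fix n assume "walk n u w"
  then have "walk (n + e) u v"
    using assms by (blast intro: walk_append)
  then show "d \<le> n"
    using assms by (auto simp: has_dist_def)
qed (rule assms)

lemma has_dist_right:
  assumes "has_dist u v (d + e)" and "walk d u w" and "walk e w v"
  shows "has_dist w v e"
  using assms by (metis add.commute has_dist_left has_dist_sym walk_sym)

section \<open>Reachability and shortest paths in terms of walk lengths\<close>

lemma reachable_iff_walk:
  assumes "u \<in> verts G"
  shows "u \<rightarrow>\<^sup>*\<^bsub>G\<^esub> v \<longleftrightarrow> (\<exists>n. walk n u v)"
  using assms by (simp add: reachable_awalk walk_iff_awalk)

text \<open>The left side minimises over paths without repeated vertices, the right side over all
  walks. The minima agree because a shortest walk repeats no vertex.\<close>

lemma shortest_path_iff:
  "shortest_path G u p v \<longleftrightarrow> awalk u p v \<and> has_dist u v (length p)"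
proof (cases "u \<in> verts G")
  case True
  have least_apath: "apath u p v" if "awalk u p v" "has_dist u v (length p)" for p
  proof (rule ccontr)
    assume "\<not> apath u p v"
    with that(1) have "\<not> distinct (awalk_verts u p)"
      by (simp add: apath_def)
    \<comment> \<open>Cutting out the closed part \<open>r\<close> leaves a strictly shorter
      walk.\<close>
    from awalk_not_distinct_decomp[OF that(1) this] obtain q r s w where
      p: "p = q @ r @ s" "0 < length r" and "awalk u q w" "awalk w s v"
      by blast
    from this(3,4) have "awalk u (q @ s) v"
      by (rule awalk_appendI)
    then have "walk (length (q @ s)) u v"
      using True walk_iff_awalk by blast
    moreover have "length (q @ s) < length p"
      using p by simp
    ultimately
    show False
      using that(2) by (auto simp: has_dist_def)
  qed
  show ?thesis
  proof
    assume sp: "shortest_path G u p v"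
    then have "awalk u p v"
      by (simp add: shortest_path_def apath_def)
    then obtain d where d: "has_dist u v d" "d \<le> length p"
      using True walk_iff_awalk walk_imp_has_dist by blast
    then obtain q where "awalk u q v" "length q = d"
      using True walk_iff_awalk by (auto simp: has_dist_def)
    then have "apath u q v"
      using d least_apath by blast
    then have "length p \<le> d"
      using sp \<open>length q = d\<close> by (auto simp: shortest_path_def)
    with d \<open>awalk u p v\<close> show "awalk u p v \<and> has_dist u v (length p)"
      by simp
  next
    assume "awalk u p v \<and> has_dist u v (length p)"
    then show "shortest_path G u p v"
      using True least_apath
      by (auto simp: shortest_path_def has_dist_def walk_iff_awalk apath_def)
  qed
next
  case False
  then show ?thesis
    by (auto simp: shortest_path_def apath_def dest: awalk_hd_in_verts)
qed

lemma mem_shortest_path_verts_iff: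
  assumes "u \<in> verts G"
  shows "w \<in> shortest_path_verts G u v \<longleftrightarrow>
    (\<exists>d e. has_dist u v (d + e) \<and> walk d u w \<and> walk e w v)"
proof
  assume "w \<in> shortest_path_verts G u v"
  then obtain p where p: "awalk u p v" "has_dist u v (length p)" "w \<in> set (awalk_verts u p)"
    by (auto simp: shortest_path_verts_def shortest_path_iff)
  then obtain q r where "p = q @ r" "awalk u q w" "awalk w r v"
    using awalk_decomp by blast
  then have "has_dist u v (length q + length r)" "walk (length q) u w" "walk (length r) w v"
    using p walk_iff_awalk awalk_hd_in_verts by auto
  then show "\<exists>d e. has_dist u v (d + e) \<and> walk d u w \<and> walk e w v"
    by blast
next
  assume "\<exists>d e. has_dist u v (d + e) \<and> walk d u w \<and> walk e w v"
  then obtain d e where de: "has_dist u v (d + e)" "walk d u w" "walk e w v"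
    by blast
  then obtain q r where qr: "awalk u q w" "length q = d" "awalk w r v" "length r = e"
    using assms walk_in_verts walk_iff_awalk by metis
  then have "shortest_path G u (q @ r) v" "w \<in> set (awalk_verts u (q @ r))"
    using de by (auto simp: shortest_path_iff awalk_verts_append)
  then show "w \<in> shortest_path_verts G u v"
    unfolding shortest_path_verts_def by blast
qed


subsection \<open>Canonical hubs\<close>

text \<open>Given \<open>has_dist u v d\<close>, the vertices \<open>w\<close> that split a walk of
  length \<open>d\<close> are exactly those of P_uv, by \<open>mem_shortest_path_verts_iff\<close>
  when \<open>u\<close> is a vertex.\<close>

definition canonical_hub :: "'a \<Rightarrow> 'a \<Rightarrow> nat \<Rightarrow> bool" where
  "canonical_hub u v d \<longleftrightarrow>
     has_dist u v d \<and> (\<forall>w a b. walk a u w \<and> walk b w v \<and> a + b = d \<longrightarrow> \<pi> u \<le> \<pi> w)"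

lemma canonical_hub_has_dist: "canonical_hub u v d \<Longrightarrow> has_dist u v d"
  by (simp add: canonical_hub_def)

lemma canonical_hub_walk: "canonical_hub u v d \<Longrightarrow> walk d u v"
  by (simp add: canonical_hub_def has_dist_def)

lemma canonical_hub_0 [simp]: "canonical_hub u v 0 \<longleftrightarrow> u = v"
  by (auto simp: canonical_hub_def has_dist_def)

lemma canonical_hub_rank:
  assumes "canonical_hub u v d"
  shows "\<pi> u \<le> \<pi> v"
proof -
  have "walk d u v" "walk 0 v v" "d + 0 = d"
    using assms canonical_hub_walk by auto
  then show ?thesis
    using assms unfolding canonical_hub_def by blast
qed

text \<open>For \<open>w\<close> in P_uv the set P_uw is contained in P_uv, so \<open>u\<close>
  keeps the highest rank. This closure lets labels spread one edge per iteration.\<close>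

lemma canonical_hub_prefix:
  assumes "canonical_hub u v (d + e)" and "walk d u w" and "walk e w v"
  shows "canonical_hub u w d"
  unfolding canonical_hub_def
proof (intro conjI allI impI)
  show "has_dist u w d"
    using assms by (auto simp: canonical_hub_def intro: has_dist_left)
next
  fix x a b assume "walk a u x \<and> walk b x w \<and> a + b = d"
  then have "walk a u x" "walk (b + e) x v" "a + (b + e) = d + e"
    using assms by (auto intro: walk_append)
  then show "\<pi> u \<le> \<pi> x"
    using assms unfolding canonical_hub_def by blast
qed

text \<open>Take \<open>w\<close> of highest rank in P_uv. Both P_wu and P_wv lie inside P_uv, so
  \<open>w\<close> is a canonical hub of both endpoints; if it does not outrank \<open>u\<close>,
  then \<open>u\<close> itself attains the minimum.\<close>

lemma highest_on_shortest_path: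
  assumes "has_dist u v d"
  obtains w a b where "a + b = d" "canonical_hub w u a" "canonical_hub w v b"
    "canonical_hub u v d \<or> \<pi> w < \<pi> u"
proof -
  define S where "S = {w. \<exists>a b. walk a u w \<and> walk b w v \<and> a + b = d}"
  have "walk 0 u u" "walk d u v" "0 + d = d"
    using assms by (auto simp: has_dist_def)
  then have "u \<in> S"
    unfolding S_def by blast
  then obtain w where w: "w \<in> S" and min: "\<And>x. x \<in> S \<Longrightarrow> \<pi> w \<le> \<pi> x"
    using ex_has_least_nat[of "\<lambda>w. w \<in> S"] by blast
  from w obtain a b where ab: "walk a u w" "walk b w v" "a + b = d"
    by (auto simp: S_def)
  have "canonical_hub w u a"
    unfolding canonical_hub_def
  proof (intro conjI allI impI)
    show "has_dist w u a"
      using assms ab by (auto intro: has_dist_sym has_dist_left)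
    fix x a' a'' assume "walk a' w x \<and> walk a'' x u \<and> a' + a'' = a"
    then have "walk a'' u x" "walk (a' + b) x v" "a'' + (a' + b) = d"
      using ab by (auto intro: walk_append walk_sym)
    then show "\<pi> w \<le> \<pi> x"
      by (intro min) (auto simp: S_def)
  qed
  moreover have "canonical_hub w v b"
    unfolding canonical_hub_def
  proof (intro conjI allI impI)
    show "has_dist w v b"
      using assms ab by (auto intro: has_dist_right)
    fix x b' b'' assume "walk b' w x \<and> walk b'' x v \<and> b' + b'' = b"
    then have "walk (a + b') u x" "walk b'' x v" "(a + b') + b'' = d"
      using ab by (auto intro: walk_append)
    then show "\<pi> w \<le> \<pi> x"
      by (intro min) (auto simp: S_def)
  qed
  moreover have "canonical_hub u v d \<or> \<pi> w < \<pi> u"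
  proof (rule disjCI)
    assume "\<not> \<pi> w < \<pi> u"
    then have "\<forall>x \<in> S. \<pi> u \<le> \<pi> x"
      using min by fastforce
    then show "canonical_hub u v d"
      using assms by (auto simp: canonical_hub_def S_def)
  qed
  ultimately show ?thesis
    using ab that by blast
qed

lemma canonical_hub_iff:
  assumes "u \<in> verts G"
  shows "(\<exists>d. canonical_hub u v d) \<longleftrightarrow>
    u \<rightarrow>\<^sup>*\<^bsub>G\<^esub> v \<and> \<not> (\<exists>w \<in> shortest_path_verts G u v. \<pi> w < \<pi> u)"
  (is "?L \<longleftrightarrow> ?R")
proof
  assume ?L
  then obtain d where d: "canonical_hub u v d"
    by blast
  have "\<pi> u \<le> \<pi> w" if w: "w \<in> shortest_path_verts G u v" for w
  proof -
    obtain a b where ab: "has_dist u v (a + b)" "walk a u w" "walk b w v"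
      using w assms by (auto simp: mem_shortest_path_verts_iff)
    then have "a + b = d"
      using d by (blast intro: has_dist_unique canonical_hub_has_dist)
    with d ab show ?thesis
      unfolding canonical_hub_def by blast
  qed
  then show ?R
    using d assms by (auto simp: reachable_iff_walk not_less dest: canonical_hub_walk)
next
  assume R: ?R
  then obtain n where "walk n u v"
    using assms by (auto simp: reachable_iff_walk)
  then obtain d where d: "has_dist u v d"
    using walk_imp_has_dist by blast
  have "\<pi> u \<le> \<pi> w" if "walk a u w" "walk b w v" "a + b = d" for w a b
  proof -
    have "w \<in> shortest_path_verts G u v"
      using d that mem_shortest_path_verts_iff[OF assms] by blast
    then have "\<not> \<pi> w < \<pi> u"
      using R by blast
    then show ?thesis
      by simp
  qed
  with d have "canonical_hub u v d"
    unfolding canonical_hub_def by blast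
  then show ?L ..
qed

definition hubs_below :: "nat \<Rightarrow> 'a \<Rightarrow> ('a \<times> nat) set" where
  "hubs_below k v = {(u, d). canonical_hub u v d \<and> d < k}"

definition hubs_at :: "nat \<Rightarrow> 'a \<Rightarrow> ('a \<times> nat) set" where
  "hubs_at k v = {(u, d). canonical_hub u v d \<and> d = k}"

lemma hubs_below_Suc: "hubs_below (Suc k) v = hubs_below k v \<union> hubs_at k v"
  by (auto simp: hubs_below_def hubs_at_def)


subsection \<open>The invariant\<close>

text \<open>Only a walk of length \<open>k\<close> is required, not distance \<open>k\<close>: a
  message can overestimate the distance when \<open>u\<close> is no canonical hub of
  \<open>v\<close>.\<close>

definition candidates :: "nat \<Rightarrow> 'a \<Rightarrow> ('a \<times> nat) set" where
  "candidates k v = {(u, d). d = k \<and> u \<in> verts G \<and> walk k u v \<and> \<pi> u < \<pi> v}"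

lemma finite_candidates: "finite (candidates k v)"
  by (rule finite_subset[of _ "verts G \<times> {k}"]) (auto simp: candidates_def)

text \<open>\<open>new_label\<close> is unconstrained for pending and for inactive idle vertices,
  where it may be left over from an earlier iteration. An idle vertex is inactive only if it has no
  hub at distance \<open>k\<close>.\<close>

definition vertex_inv :: "nat \<Rightarrow> 'a vc_config \<Rightarrow> 'a \<Rightarrow> bool" where
  "vertex_inv k c v \<longleftrightarrow>
     (case phase c v of
       Idle \<Rightarrow> label c v = hubs_below (Suc k) v \<and> inbox c v = {} \<and>
         (if v \<in> active c then new_label c v = hubs_at k v else hubs_at k v = {})
     | Pending \<Rightarrow> label c v = hubs_below k v \<and> v \<notin> active c \<and>
         inbox c v \<subseteq> candidates k v \<and> hubs_at k v \<subseteq> inbox c v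
     | Busy \<Rightarrow> label c v = hubs_below k v \<and> v \<notin> active c \<and>
         inbox c v \<subseteq> candidates k v \<and> new_label c v \<subseteq> hubs_at k v \<and>
         hubs_at k v \<subseteq> inbox c v \<union> new_label c v)"

definition vc_inv :: "nat \<Rightarrow> 'a vc_config \<Rightarrow> bool" where
  "vc_inv k c \<longleftrightarrow>
     active c \<subseteq> verts G \<and> (\<forall>v. phase c v \<noteq> Idle \<longrightarrow> v \<in> verts G) \<and>
     (\<forall>v \<in> verts G. vertex_inv k c v)"

text \<open>Initialization looks like the end of an iteration 0: the only hub at distance 0 is the
  vertex itself.\<close>

lemma vc_inv_init: "vc_inv 0 (vc_init G)"
  by (auto simp: vc_inv_def vertex_inv_def vc_init_def hubs_below_def hubs_at_def)

lemma vc_inv_busyD: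
  assumes "vc_inv k c" and "phase c v = Busy"
  shows "v \<in> verts G" "label c v = hubs_below k v" "v \<notin> active c" "inbox c v \<subseteq> candidates k v"
    "new_label c v \<subseteq> hubs_at k v" "hubs_at k v \<subseteq> inbox c v \<union> new_label c v"
proof -
  show v: "v \<in> verts G"
    using assms by (auto simp: vc_inv_def)
  then have "vertex_inv k c v"
    using assms by (simp add: vc_inv_def)
  then show "label c v = hubs_below k v" "v \<notin> active c" "inbox c v \<subseteq> candidates k v"
    "new_label c v \<subseteq> hubs_at k v" "hubs_at k v \<subseteq> inbox c v \<union> new_label c v"
    using assms(2) by (auto simp: vertex_inv_def)
qed

lemma vc_inv_label:
  assumes "vc_inv k c" and "v \<in> verts G"
  shows "hubs_below k v \<subseteq> label c v" "label c v \<subseteq> hubs_below (Suc k) v"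
proof -
  have "vertex_inv k c v"
    using assms by (simp add: vc_inv_def)
  then have "label c v = hubs_below k v \<or> label c v = hubs_below (Suc k) v"
    by (auto simp: vertex_inv_def split: phase.splits)
  then show "hubs_below k v \<subseteq> label c v" "label c v \<subseteq> hubs_below (Suc k) v"
    by (auto simp: hubs_below_Suc)
qed

text \<open>Frame rule for gather steps: \<open>vertex_inv\<close> at \<open>w\<close> reads the
  configuration only at \<open>w\<close>, so a step that changes \<open>v\<close> alone needs
  checking only at \<open>v\<close>.\<close>

lemma vc_inv_local:
  assumes "vc_inv k c" and "v \<in> verts G" and "vertex_inv k c' v"
    and "\<And>w. w \<noteq> v \<Longrightarrow> label c' w = label c w \<and> new_label c' w = new_label c w \<and>
      inbox c' w = inbox c w \<and> phase c' w = phase c w \<and> (w \<in> active c' \<longleftrightarrow> w \<in> active c)"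
  shows "vc_inv k c'"
proof -
  have "vertex_inv k c' w" if "w \<in> verts G" for w
  proof (cases "w = v")
    case False
    have "vertex_inv k c w"
      using assms(1) that by (simp add: vc_inv_def)
    then show ?thesis
      using assms(4)[OF False] by (cases "phase c w") (simp_all add: vertex_inv_def)
  qed (use assms(3) in simp)
  moreover have "w \<in> verts G" if "w \<in> active c'" for w
    using assms(1,2) assms(4)[of w] that by (cases "w = v") (auto simp: vc_inv_def)
  moreover have "w \<in> verts G" if "phase c' w \<noteq> Idle" for w
    using assms(1,2) assms(4)[of w] that by (cases "w = v") (auto simp: vc_inv_def)
  ultimately show ?thesis
    by (auto simp: vc_inv_def)
qed

text \<open>In the gather stage other vertices may have updated their labels already, so all that is
  known about the label of \<open>u\<close> here is that it contains the hubs at distance less than \<open>k\<close> and only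
  hubs at distance at most \<open>k\<close>.\<close>

lemma distance_check_iff:
  assumes inv: "vc_inv k c" and busy: "phase c v = Busy" and cand: "(u, d) \<in> candidates k v"
  shows "enat d < label_distance (label c) u v \<longleftrightarrow> canonical_hub u v k"
proof
  have u: "u \<in> verts G" "walk k u v" "\<pi> u < \<pi> v" and [simp]: "d = k"
    using cand by (auto simp: candidates_def)
  have Lv: "label c v = hubs_below k v" and v: "v \<in> verts G"
    using vc_inv_busyD[OF inv busy] by auto
  \<comment> \<open>A walk of length 0 would give \<open>u = v\<close>, against
    \<open>\<pi> u < \<pi> v\<close>.\<close>
  have k: "0 < k"
    using u by (cases k) auto
  {
    assume far: "enat d < label_distance (label c) u v"
    obtain e where e: "e \<le> k" "has_dist u v e"
      using u walk_imp_has_dist by blast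
    then obtain w a b where w: "a + b = e" "canonical_hub w u a" "canonical_hub w v b"
      "canonical_hub u v e \<or> \<pi> w < \<pi> u"
      by (blast elim: highest_on_shortest_path)
    show "canonical_hub u v k"
    proof (cases "canonical_hub u v e")
      case True
      have "e = k"
      proof (rule ccontr)
        assume "e \<noteq> k"
        \<comment> \<open>With \<open>e < k\<close> the vertex \<open>u\<close> is already recorded
          at \<open>v\<close>, and \<open>u\<close> as common hub, at distance 0 from itself,
          defeats the message.\<close>
        then have "(u, e) \<in> label c v" "(u, 0) \<in> label c u"
          using True e k Lv vc_inv_label[OF inv \<open>u \<in> verts G\<close>] by (auto simp: hubs_below_def)
        then have "k < 0 + e"
          using far unfolding less_label_distance_iff \<open>d = k\<close> by blast
        with e show False
          by simp
      qed
      with True show ?thesis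
        by simp
    next
      case False
      \<comment> \<open>Here \<open>\<pi> w < \<pi> u < \<pi> v\<close>. So \<open>a\<close> and
        \<open>b\<close> are both positive, hence both less than \<open>k\<close>, and
        \<open>w\<close> is in both labels whatever phase \<open>u\<close> is in.\<close>
      with w u have "w \<noteq> u" "w \<noteq> v"
        by auto
      then have "a \<noteq> 0" "b \<noteq> 0"
        using w by (metis canonical_hub_0)+
      then have "(w, a) \<in> label c u" "(w, b) \<in> label c v"
        using w e Lv vc_inv_label[OF inv \<open>u \<in> verts G\<close>] by (auto simp: hubs_below_def)
      then have "k < a + b"
        using far unfolding less_label_distance_iff \<open>d = k\<close> by blast
      with w e show ?thesis
        by simp
    qed
  next
    assume hub: "canonical_hub u v k"
    show "enat d < label_distance (label c) u v"
      unfolding less_label_distance_iff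
    proof (intro allI impI, rule ccontr)
      fix h a b
      assume h: "(h, a) \<in> label c u" "(h, b) \<in> label c v" and "\<not> d < a + b"
      then have le: "a + b \<le> k"
        by simp
      have hu: "canonical_hub h u a" and hv: "canonical_hub h v b" "b < k"
        using h Lv vc_inv_label[OF inv \<open>u \<in> verts G\<close>] by (auto simp: hubs_below_def)
      then have uh: "walk a u h" and wv: "walk b h v"
        by (auto intro: canonical_hub_walk walk_sym)
      then have "walk (a + b) u v"
        by (rule walk_append)
      \<comment> \<open>As \<open>k\<close> is the distance, \<open>h\<close> lies in P_uv, so
        \<open>u\<close> ranks at least as high as \<open>h\<close>; being a hub of
        \<open>u\<close>, \<open>h\<close> ranks at least as high as \<open>u\<close>. Thus
        \<open>h = u\<close>, and \<open>b = k\<close> contradicts \<open>b < k\<close>.\<close>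
      with hub le have "a + b = k"
        by (auto simp: canonical_hub_def has_dist_def)
      then have "\<pi> u \<le> \<pi> h"
        using hub uh wv unfolding canonical_hub_def by blast
      moreover have "\<pi> h \<le> \<pi> u"
        using hu by (rule canonical_hub_rank)
      moreover have "h \<in> verts G"
        using uh u walk_in_verts by blast
      ultimately have "h = u"
        using u inj_rank by (simp add: inj_on_def)
      with hu have "a = 0"
        by (auto dest: canonical_hub_has_dist)
      with \<open>a + b = k\<close> hv show False
        by simp
    qed
  }
qed

section \<open>The scatter stage\<close>

lemma hubs_at_Suc_subset_scatter:
  assumes inv: "vc_inv k c" and idle: "\<forall>v. phase c v = Idle" and v: "v \<in> verts G"
  shows "hubs_at (Suc k) v \<subseteq> scatter_messages G \<pi> c v"
proof clarify
  fix u d assume "(u, d) \<in> hubs_at (Suc k) v"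
  then have d: "d = Suc k" and hub: "canonical_hub u v (k + Suc 0)"
    by (auto simp: hubs_at_def)
  \<comment> \<open>\<open>a\<close> is the last vertex before \<open>v\<close> on a shortest path.
    By prefix closure it has the hub \<open>u\<close> at distance \<open>k\<close>, which forces it
    to be active with \<open>(u, k)\<close> in its new label.\<close>
  then obtain a where a: "walk k u a" "walk (Suc 0) a v"
    using canonical_hub_walk walk_split by blast
  with hub have "canonical_hub u a k"
    by (rule canonical_hub_prefix)
  then have "(u, k) \<in> hubs_at k a"
    by (simp add: hubs_at_def)
  moreover have "a \<in> verts G"
    using a v walk_in_verts by blast
  ultimately have "a \<in> active c" "(u, k) \<in> new_label c a"
    using inv idle by (auto simp: vc_inv_def vertex_inv_def split: if_splits)
  moreover have "\<pi> u < \<pi> v"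
  proof -
    have "u \<noteq> v"
      using hub by (auto dest: canonical_hub_has_dist)
    moreover have "u \<in> verts G"
      using hub v canonical_hub_walk walk_in_verts by blast
    ultimately have "\<pi> u \<noteq> \<pi> v"
      using v inj_rank by (auto simp: inj_on_def)
    with canonical_hub_rank[OF hub] show ?thesis
      by simp
  qed
  \<comment> \<open>Recorded distances are exact and at most \<open>k\<close>, whereas
    \<open>u\<close> is at distance \<open>k + 1\<close>.\<close>
  moreover have "u \<notin> hubs (label c) v"
  proof
    assume "u \<in> hubs (label c) v"
    then obtain e where "canonical_hub u v e" "e < Suc k"
      using vc_inv_label[OF inv v] by (auto simp: hubs_def hubs_below_def)
    moreover have "e = k + Suc 0"
      using hub \<open>canonical_hub u v e\<close> by (blast intro: has_dist_unique canonical_hub_has_dist)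
    ultimately show False
      by simp
  qed
  ultimately show "(u, d) \<in> scatter_messages G \<pi> c v"
    using a d by (auto simp: scatter_messages_def)
qed

lemma scatter_subset_candidates:
  assumes inv: "vc_inv k c" and idle: "\<forall>v. phase c v = Idle"
  shows "scatter_messages G \<pi> c v \<subseteq> candidates (Suc k) v"
proof clarify
  fix u d assume "(u, d) \<in> scatter_messages G \<pi> c v"
  then obtain e a where a: "d = e + 1" "a \<in> active c" "a \<rightarrow>\<^bsub>G\<^esub> v" "(u, e) \<in> new_label c a" "\<pi> u < \<pi> v"
    by (auto simp: scatter_messages_def)
  then have "a \<in> verts G"
    by (auto dest: adj_in_verts)
  with a have "(u, e) \<in> hubs_at k a"
    using inv idle by (auto simp: vc_inv_def vertex_inv_def)
  then have "e = k" "walk k u a"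
    by (auto simp: hubs_at_def dest: canonical_hub_walk)
  moreover have "walk (k + Suc 0) u v"
    using \<open>walk k u a\<close> a by (intro walk_append) auto
  ultimately show "(u, d) \<in> candidates (Suc k) v"
    using a \<open>a \<in> verts G\<close> walk_in_verts by (auto simp: candidates_def)
qed

lemma scatter_in_verts: "scatter_messages G \<pi> c v \<noteq> {} \<Longrightarrow> v \<in> verts G"
  by (auto simp: scatter_messages_def dest: adj_in_verts)

section \<open>Preservation of the invariant\<close>

lemma vc_inv_step:
  assumes "vc_step G \<pi> c c'" and inv: "vc_inv k c"
  shows "\<exists>k. vc_inv k c'"
  using assms(1)
proof cases
  case (scatter M)
  \<comment> \<open>Only scattering advances \<open>k\<close>. A vertex without messages becomes
    idle at once, which is sound because every hub at distance \<open>Suc k\<close> is among the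
    messages.\<close>
  have "vertex_inv (Suc k) c' v" if "v \<in> verts G" for v
  proof -
    have "label c v = hubs_below (Suc k) v"
      using inv that scatter by (simp add: vc_inv_def vertex_inv_def)
    then show ?thesis
      using scatter hubs_at_Suc_subset_scatter[OF inv _ that] scatter_subset_candidates[OF inv]
      by (auto simp: vertex_inv_def hubs_below_Suc)
  qed
  then have "vc_inv (Suc k) c'"
    using scatter scatter_in_verts by (auto simp: vc_inv_def)
  then show ?thesis ..
next
  case (gather_start v)
  then have v: "v \<in> verts G"
    using inv by (simp add: vc_inv_def)
  then have "vertex_inv k c v"
    using inv by (simp add: vc_inv_def)
  then have "vertex_inv k c' v"
    using gather_start by (simp add: vertex_inv_def)
  then have "vc_inv k c'"
    by (rule vc_inv_local[OF inv v]) (simp add: gather_start)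
  then show ?thesis ..
next
  case (gather_accept v u d)
  note busy = vc_inv_busyD[OF inv \<open>phase c v = Busy\<close>]
  have "(u, d) \<in> candidates k v"
    using gather_accept busy by blast
  then have "(u, d) \<in> hubs_at k v"
    using gather_accept distance_check_iff[OF inv] by (auto simp: hubs_at_def candidates_def)
  then have "vertex_inv k c' v"
    using gather_accept busy by (auto simp: vertex_inv_def)
  then have "vc_inv k c'"
    by (rule vc_inv_local[OF inv busy(1)]) (simp add: gather_accept)
  then show ?thesis ..
next
  case (gather_reject v u d)
  note busy = vc_inv_busyD[OF inv \<open>phase c v = Busy\<close>]
  have "(u, d) \<in> candidates k v"
    using gather_reject busy by blast
  then have "(u, d) \<notin> hubs_at k v"
    using gather_reject distance_check_iff[OF inv] by (auto simp: hubs_at_def)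
  then have "vertex_inv k c' v"
    using gather_reject busy by (auto simp: vertex_inv_def)
  then have "vc_inv k c'"
    by (rule vc_inv_local[OF inv busy(1)]) (simp add: gather_reject)
  then show ?thesis ..
next
  case (gather_finish_changed v)
  note busy = vc_inv_busyD[OF inv \<open>phase c v = Busy\<close>]
  have "new_label c v = hubs_at k v"
    using gather_finish_changed busy by blast
  then have "vertex_inv k c' v"
    using gather_finish_changed busy by (simp add: vertex_inv_def hubs_below_Suc)
  then have "vc_inv k c'"
    by (rule vc_inv_local[OF inv busy(1)]) (simp add: gather_finish_changed)
  then show ?thesis ..
next
  case (gather_finish_unchanged v)
  note busy = vc_inv_busyD[OF inv \<open>phase c v = Busy\<close>]
  have "hubs_at k v = {}"
    using gather_finish_unchanged busy by blast
  then have "vertex_inv k c' v"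
    using gather_finish_unchanged busy by (simp add: vertex_inv_def hubs_below_Suc)
  then have "vc_inv k c'"
    by (rule vc_inv_local[OF inv busy(1)]) (simp add: gather_finish_unchanged)
  then show ?thesis ..
qed


subsection \<open>Termination\<close>

definition missing :: "'a vc_config \<Rightarrow> ('a \<times> 'a) set" where
  "missing c = {(u, v) \<in> verts G \<times> verts G. u \<notin> hubs (label c) v}"

fun phase_weight :: "phase \<Rightarrow> nat" where
  "phase_weight Idle = 0"
| "phase_weight Busy = 1"
| "phase_weight Pending = 2"

text \<open>Lexicographic order. Scattering empties the active set but raises phases and inboxes, so
  these come later; finishing with a change enlarges the active set but records a missing pair, so
  missing pairs come first. The phase weights fall along Pending, Busy, Idle.\<close>

definition vc_rel :: "('a vc_config \<times> 'a vc_config) set" where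
  "vc_rel = measures
     [\<lambda>c. card (missing c), \<lambda>c. card (active c), \<lambda>c. \<Sum>v \<in> verts G. phase_weight (phase c v),
      \<lambda>c. \<Sum>v \<in> verts G. card (inbox c v)]"

lemma wf_vc_rel: "wf vc_rel"
  by (simp add: vc_rel_def)

lemma finite_missing: "finite (missing c)"
  by (rule finite_subset[of _ "verts G \<times> verts G"]) (auto simp: missing_def)

lemma phase_weight_less:
  assumes "v \<in> verts G" and "phase_weight x < phase_weight (f v)"
  shows "(\<Sum>w \<in> verts G. phase_weight ((f(v := x)) w)) < (\<Sum>w \<in> verts G. phase_weight (f w))"
proof -
  have "(\<lambda>w. phase_weight ((f(v := x)) w)) = (\<lambda>w. phase_weight (f w))(v := phase_weight x)"
    by auto
  with assms show ?thesis
    by (simp only:) (rule sum_fun_upd_less; simp)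
qed

lemma inbox_less:
  assumes "v \<in> verts G" and "finite (f v)" and "m \<in> f v"
  shows "(\<Sum>w \<in> verts G. card ((f(v := f v - {m})) w)) < (\<Sum>w \<in> verts G. card (f w))"
proof -
  have "(\<lambda>w. card ((f(v := f v - {m})) w)) = (\<lambda>w. card (f w))(v := card (f v - {m}))"
    by auto
  moreover have "card (f v - {m}) < card (f v)"
    using assms by (simp only: card_Diff1_less)
  ultimately show ?thesis
    using assms by (simp only:) (rule sum_fun_upd_less; simp)
qed

lemma vc_step_decreases:
  assumes "vc_step G \<pi> c c'" and inv: "vc_inv k c"
  shows "(c', c) \<in> vc_rel"
  using assms(1)
proof cases
  case (scatter M)
  moreover have "finite (active c)"
    using inv by (auto simp: vc_inv_def intro: finite_subset)
  ultimately show ?thesis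
    by (simp add: vc_rel_def missing_def card_gt_0_iff)
next
  case (gather_start v)
  moreover have "v \<in> verts G"
    using gather_start inv by (simp add: vc_inv_def)
  ultimately show ?thesis
    using phase_weight_less[of v Busy "phase c"] by (simp add: vc_rel_def missing_def)
next
  case (gather_accept v u d)
  note busy = vc_inv_busyD[OF inv \<open>phase c v = Busy\<close>]
  \<comment> \<open>Infinite sets have \<open>card\<close> 0, so removing a message decreases the
    count only for a finite inbox.\<close>
  have "finite (inbox c v)"
    using busy(4) finite_candidates by (rule finite_subset)
  with busy(1) have "(\<Sum>w \<in> verts G. card (((inbox c)(v := inbox c v - {(u, d)})) w))
      < (\<Sum>w \<in> verts G. card (inbox c w))"
    using \<open>(u, d) \<in> inbox c v\<close> by (rule inbox_less)
  with gather_accept show ?thesis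
    by (simp add: vc_rel_def missing_def)
next
  case (gather_reject v u d)
  note busy = vc_inv_busyD[OF inv \<open>phase c v = Busy\<close>]
  have "finite (inbox c v)"
    using busy(4) finite_candidates by (rule finite_subset)
  with busy(1) have "(\<Sum>w \<in> verts G. card (((inbox c)(v := inbox c v - {(u, d)})) w))
      < (\<Sum>w \<in> verts G. card (inbox c w))"
    using \<open>(u, d) \<in> inbox c v\<close> by (rule inbox_less)
  with gather_reject show ?thesis
    by (simp add: vc_rel_def missing_def)
next
  case (gather_finish_changed v)
  note busy = vc_inv_busyD[OF inv \<open>phase c v = Busy\<close>]
  obtain u d where u: "(u, d) \<in> new_label c v"
    using gather_finish_changed by fastforce
  with busy have hub: "canonical_hub u v k"
    by (auto simp: hubs_at_def)
  \<comment> \<open>The new hub is at distance exactly \<open>k\<close>, the recorded ones are at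
    smaller distances; so the pair \<open>(u, v)\<close> really was missing.\<close>
  have "u \<notin> hubs (label c) v"
  proof
    assume "u \<in> hubs (label c) v"
    then obtain e where "canonical_hub u v e" "e < k"
      using busy by (auto simp: hubs_def hubs_below_def)
    moreover have "e = k"
      using hub \<open>canonical_hub u v e\<close> by (blast intro: has_dist_unique canonical_hub_has_dist)
    ultimately show False
      by simp
  qed
  moreover have "u \<in> verts G"
    using hub busy(1) canonical_hub_walk walk_in_verts by blast
  ultimately have "(u, v) \<in> missing c"
    using busy(1) by (simp add: missing_def)
  moreover have "(u, v) \<notin> missing c'"
    using gather_finish_changed u by (force simp: missing_def hubs_def)
  moreover have "missing c' \<subseteq> missing c"
    using gather_finish_changed by (auto simp: missing_def hubs_def)
  ultimately have "card (missing c') < card (missing c)"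
    by (intro psubset_card_mono finite_missing) auto
  then show ?thesis
    by (simp add: vc_rel_def)
next
  case (gather_finish_unchanged v)
  then show ?thesis
    using phase_weight_less[of v Idle "phase c"] vc_inv_busyD(1)[OF inv]
    by (simp add: vc_rel_def missing_def)
qed

lemma vc_inv_steps:
  assumes "(vc_step G \<pi>)\<^sup>*\<^sup>* (vc_init G) c"
  shows "\<exists>k. vc_inv k c"
  using assms by induction (use vc_inv_init vc_inv_step in blast)+

lemma terminates: "vc_pll_terminates G \<pi>"
  unfolding vc_pll_terminates_def
proof
  assume "\<exists>c. c 0 = vc_init G \<and> (\<forall>i::nat. vc_step G \<pi> (c i) (c (Suc i)))"
  then obtain c where c: "c 0 = vc_init G" "\<And>i. vc_step G \<pi> (c i) (c (Suc i))"
    by blast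
  have "\<exists>k. vc_inv k (c i)" for i
    by (induction i) (use c vc_inv_init vc_inv_step in metis)+
  then have "(c (Suc i), c i) \<in> vc_rel" for i
    using c vc_step_decreases by blast
  then show False
    using wf_vc_rel by (metis wf_iff_no_infinite_down_chain)
qed

text \<open>Well-founded induction along \<open>vc_rel\<close>: a configuration that is not an exit
  has a step, and that step decreases. This yields the existence of an output.\<close>

lemma exit_reachable:
  assumes "vc_inv k c"
  shows "\<exists>c'. (vc_step G \<pi>)\<^sup>*\<^sup>* c c' \<and> vc_exit c'"
  using wf_vc_rel assms
proof (induction c arbitrary: k rule: wf_induct_rule)
  case (less c)
  show ?case
  proof (cases "vc_exit c")
    case False
    then obtain c' where step: "vc_step G \<pi> c c'"
      using vc_step_iff_not_exit by blast
    then obtain k' where "vc_inv k' c'"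
      using less.prems vc_inv_step by blast
    then obtain c'' where "(vc_step G \<pi>)\<^sup>*\<^sup>* c' c''" "vc_exit c''"
      using less step vc_step_decreases by blast
    with step show ?thesis
      by (meson converse_rtranclp_into_rtranclp)
  qed blast
qed


subsection \<open>Correctness of the output\<close>

text \<open>On exit no vertex is active, so no vertex has a hub at distance exactly
  \<open>k\<close>. A hub at a distance of at least \<open>k\<close> would, by prefix closure, be a
  hub at distance \<open>k\<close> of an intermediate vertex.\<close>

lemma label_at_exit:
  assumes inv: "vc_inv k c" and "vc_exit c" and v: "v \<in> verts G"
  shows "label c v = {(u, d). canonical_hub u v d}"
proof -
  have final: "label c w = hubs_below (Suc k) w" "hubs_at k w = {}" if "w \<in> verts G" for w
    using assms that by (auto simp: vc_inv_def vertex_inv_def vc_exit_def)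
  have "d < Suc k" if hub: "canonical_hub u v d" for u d
  proof (rule ccontr)
    assume "\<not> d < Suc k"
    then have "k \<le> d"
      by simp
    then obtain e where d: "d = k + e"
      by (rule less_eqE)
    with hub obtain a where a: "walk k u a" "walk e a v"
      using canonical_hub_walk walk_split by blast
    then have "canonical_hub u a k"
      using hub unfolding d by (blast intro: canonical_hub_prefix)
    moreover have "a \<in> verts G"
      using a v walk_in_verts by blast
    ultimately show False
      using final(2)[of a] by (auto simp: hubs_at_def)
  qed
  then show ?thesis
    using final(1)[OF v] by (auto simp: hubs_below_def)
qed

lemma canonical_hhl_output:
  assumes "vc_pll_output G \<pi> L"
  shows "canonical_hhl G \<pi> L"
proof -
  obtain c k where "vc_inv k c" "vc_exit c" "L = label c"
    using assms vc_inv_steps unfolding vc_pll_output_def by blast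
  then have "u \<in> hubs L v \<longleftrightarrow> (\<exists>d. canonical_hub u v d)" if "v \<in> verts G" for u v
    using label_at_exit that by (force simp: hubs_def)
  then show ?thesis
    by (simp add: canonical_hhl_def canonical_hub_iff)
qed

end

theorem theorem1:
  fixes G :: "('a, 'b) pre_digraph" and \<pi> :: "'a \<Rightarrow> nat"
  assumes "graph G"
    and "bij_betw \<pi> (verts G) {1..card (verts G)}"
  shows "vc_pll_terminates G \<pi> \<and>
    (\<exists>L. vc_pll_output G \<pi> L) \<and>
    (\<forall>L. vc_pll_output G \<pi> L \<longrightarrow> canonical_hhl G \<pi> L)"
proof -
  interpret ranked_graph G \<pi>
    using assms by (simp add: ranked_graph_def ranked_graph_axioms_def bij_betw_def)
  show ?thesis
    using terminates exit_reachable[OF vc_inv_init] canonical_hhl_output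
    by (auto simp: vc_pll_output_def)
qed

end
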